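(* Let $n$ be a positive integer such that $17\mid 2n^2+2n+1$ and $8n+1$ is not a perfect square. Let $m=(2n^2+2n+1)/17$ and let $C_{17}$ be the cyclic group of order $17$. Then there is no element $\overline{T}=\sum_{g\in C_{17}}a_g g\in\mathbb{Z}[C_{17}]$ with nonnegative integer coefficients and $\sum_g a_g=2n+1$ (i.e. a multiset of $2n+1$ elements of $C_{17}$) satisfying both (b') $\overline{T}=\overline{T}^{(-1)}$, and (c') $\overline{T}^2=2mC_{17}-\overline{T}^{(2)}+2n$ in $\mathbb{Z}[C_{17}]$.
   Context: In the group ring $\mathbb{Z}[C_{17}]$, $C_{17}$ denotes $\sum_{g\in C_{17}}g$, an integer $k$ denotes $k$ times the identity, and for $A=\sum_g a_g g$ and an integer $t$, $A^{(t)}=\sum_g a_g g^t$. *)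

theory Defs
  imports
    "HOL-Library.Poly_Mapping"
    "HOL-Library.Numeral_Type"
    "HOL-Computational_Algebra.Nth_Powers"
begin

text \<open>
  The cyclic group of order 17, written additively, is the additive group of the type \<open>17\<close> of
  integers modulo 17; the group element \<open>g\<^sup>t\<close> thus becomes \<open>of_int t * g\<close>.
  The group ring \<open>\<int>[C\<^sub>1\<^sub>7]\<close> is \<open>C17 \<Rightarrow>\<^sub>0 int\<close>, on which multiplication is
  convolution and \<open>of_int k\<close> is \<open>k\<close> times the identity.
\<close>

type_synonym C17 = "17"

lemma card_C17: "CARD(C17) = 17"
  by simp

lemma C17_cyclic: "\<exists>k::int. (g :: C17) = of_int k"
  by (cases g) auto

definition group_sum :: "C17 \<Rightarrow>\<^sub>0 int" where
  "group_sum = (\<Sum>g\<in>UNIV. Poly_Mapping.single g 1)"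

definition gr_pow :: "(C17 \<Rightarrow>\<^sub>0 int) \<Rightarrow> int \<Rightarrow> (C17 \<Rightarrow>\<^sub>0 int)" where
  "gr_pow A t = (\<Sum>g\<in>UNIV. Poly_Mapping.single (of_int t * g) (Poly_Mapping.lookup A g))"

end

theory Submission
  imports Defs
begin

text \<open>
  An element of \<open>\<int>[C\<^sub>1\<^sub>7]\<close> whose augmentation is prime to 17 is not a zero divisor: its 17th
  power is, modulo 17, an integer prime to 17, so anything it kills is infinitely divisible by 17.

  Write \<open>x\<^sub>0 = T\<close> and \<open>x\<^sub>i\<^sub>+\<^sub>1 = x\<^sub>i\<^sup>(\<^sup>2\<^sup>)\<close>. Since \<open>2\<^sup>4 = -1\<close> modulo 17, symmetry of \<open>T\<close> makes the sequence
  4-periodic, and \<open>x\<^sub>i\<^sub>+\<^sub>1 = k - x\<^sub>i\<^sup>2\<close> for a constant \<open>k\<close>. A periodic orbit of this map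
  satisfies \<open>(x\<^sub>0 - x\<^sub>2) (1 + (x\<^sub>0 + x\<^sub>2) (x\<^sub>1 + x\<^sub>3)) = 0\<close>, and once \<open>x\<^sub>2 = x\<^sub>0\<close> it satisfies
  \<open>(x\<^sub>0 - x\<^sub>1) (x\<^sub>0 + x\<^sub>1 - 1) = 0\<close>. With \<open>s = 2n + 1\<close> one has \<open>s\<^sup>2 = -1\<close> modulo 17, so the augmentations
  \<open>1 + 4s\<^sup>2\<close> and \<open>2s - 1\<close> of the second factors are prime to 17, and \<open>T = T\<^sup>(\<^sup>2\<^sup>)\<close>.

  Hence \<open>T\<close> is constant, with values \<open>b\<close> and \<open>c\<close>, on the nonzero squares and on the nonsquares of
  \<open>\<int>/17\<close>. With \<open>a\<close> the coefficient at the identity, comparing coefficients of \<open>T\<^sup>2\<close> gives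
  \<open>(b - c) (2a + 1 - b - c) = 0\<close>. If \<open>b = c\<close> then \<open>8n + 1 = (2(a - b) + 1)\<^sup>2\<close>; otherwise
  \<open>s = 17a + 8\<close>, which contradicts \<open>s\<^sup>2 = -1\<close> modulo 17.
\<close>

section \<open>Frobenius congruence modulo a prime in a commutative ring\<close>

lemma prime_dvd_power_add_diff:
  fixes x y :: "'a::comm_ring_1"
  assumes "prime p"
  shows "of_nat p dvd (x + y) ^ p - (x ^ p + y ^ p)"
proof -
  have p: "p > 1" using assms by (rule prime_gt_1_nat)
  have "(x + y) ^ p = (\<Sum>k\<le>p. of_nat (p choose k) * x ^ k * y ^ (p - k))"
    by (rule binomial_ring)
  also have "{..p} = insert 0 (insert p {1..<p})" using p by auto
  finally have "(x + y) ^ p - (x ^ p + y ^ p)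
      = (\<Sum>k\<in>{1..<p}. of_nat (p choose k) * x ^ k * y ^ (p - k))"
    using p by (simp add: algebra_simps)
  moreover have "of_nat p dvd (of_nat (p choose k) * x ^ k * y ^ (p - k) :: 'a)"
    if "k \<in> {1..<p}" for k
  proof -
    have "p dvd p choose k"
      using that assms by (intro dvd_choose_prime) auto
    then have "of_nat p dvd (of_nat (p choose k) :: 'a)"
      by (auto simp: dvd_def)
    then show ?thesis by (simp add: dvd_mult2)
  qed
  ultimately show ?thesis by (simp only: dvd_sum)
qed

text \<open>Stated by divisibility in an arbitrary commutative ring because it serves twice below:
  for the integers and for the monomials of the group ring.\<close>

lemma prime_dvd_power_sum_diff:
  fixes f :: "'b \<Rightarrow> 'a::comm_ring_1"
  assumes "prime p"
  shows "of_nat p dvd (\<Sum>i\<in>A. f i) ^ p - (\<Sum>i\<in>A. f i ^ p)"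
proof (induction A rule: infinite_finite_induct)
  case (insert i A)
  have "of_nat p dvd ((f i + sum f A) ^ p - (f i ^ p + sum f A ^ p))
      + (sum f A ^ p - (\<Sum>i\<in>A. f i ^ p))"
    using prime_dvd_power_add_diff[OF assms] insert.IH by (rule dvd_add)
  then show ?case using insert.hyps by (simp add: algebra_simps)
qed (use assms prime_gt_0_nat in \<open>auto simp: power_0_left\<close>)

section \<open>Convolution, augmentation and power maps in the group ring\<close>

lemma single_power:
  fixes g :: "'a::comm_semiring_1" and a :: "'b::comm_semiring_1"
  shows "Poly_Mapping.single g a ^ k = Poly_Mapping.single (of_nat k * g) (a ^ k)"
  by (induction k) (simp_all add: mult_single algebra_simps)

lemma sum_single_lookup:
  fixes A :: "'a::finite \<Rightarrow>\<^sub>0 'b::comm_monoid_add"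
  shows "(\<Sum>g\<in>UNIV. Poly_Mapping.single g (Poly_Mapping.lookup A g)) = A"
  by (rule poly_mapping_eqI) (simp add: lookup_sum lookup_single when_def)

lemma lookup_mult_finite:
  fixes A B :: "'a::{finite,ab_group_add} \<Rightarrow>\<^sub>0 'b::comm_semiring_0"
  shows "Poly_Mapping.lookup (A * B) g
    = (\<Sum>h\<in>UNIV. Poly_Mapping.lookup A h * Poly_Mapping.lookup B (g - h))"
proof -
  have "A * B = (\<Sum>h\<in>UNIV. \<Sum>k\<in>UNIV. Poly_Mapping.single h (Poly_Mapping.lookup A h)
      * Poly_Mapping.single k (Poly_Mapping.lookup B k))"
    by (subst (1 2) sum_single_lookup[symmetric]) (simp add: sum_product)
  then have "Poly_Mapping.lookup (A * B) g = (\<Sum>h\<in>UNIV. \<Sum>k\<in>UNIV.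
      if k = g - h then Poly_Mapping.lookup A h * Poly_Mapping.lookup B k else 0)"
    by (auto simp: lookup_sum mult_single lookup_single when_def algebra_simps intro!: sum.cong)
  then show ?thesis by simp
qed

definition aug :: "('a::finite \<Rightarrow>\<^sub>0 'b::comm_monoid_add) \<Rightarrow> 'b" where
  "aug A = (\<Sum>g\<in>UNIV. Poly_Mapping.lookup A g)"

lemma aug_add: "aug (A + B) = aug A + aug B"
  by (simp add: aug_def lookup_add sum.distrib)

lemma aug_single: "aug (Poly_Mapping.single g a) = a"
  by (simp add: aug_def lookup_single when_def)

lemma aug_one: "aug (1 :: 'a::{finite,zero} \<Rightarrow>\<^sub>0 'b::comm_semiring_1) = 1"
  using aug_single[of 0 "1 :: 'b"] by simp

lemma aug_mult:
  fixes A B :: "'a::{finite,ab_group_add} \<Rightarrow>\<^sub>0 'b::comm_semiring_0"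
  shows "aug (A * B) = aug A * aug B"
proof -
  have "aug (A * B) = (\<Sum>h\<in>UNIV. \<Sum>g\<in>UNIV.
      Poly_Mapping.lookup A h * Poly_Mapping.lookup B (g - h))"
    unfolding aug_def lookup_mult_finite by (rule sum.swap)
  also have "\<dots> = (\<Sum>h\<in>UNIV. Poly_Mapping.lookup A h * aug B)"
  proof (rule sum.cong)
    fix h :: 'a
    have "(\<Sum>g\<in>UNIV. Poly_Mapping.lookup B (g - h)) = aug B"
      unfolding aug_def
      by (rule sum.reindex_bij_witness[where i = "\<lambda>g. g + h" and j = "\<lambda>g. g - h"]) auto
    then show "(\<Sum>g\<in>UNIV. Poly_Mapping.lookup A h * Poly_Mapping.lookup B (g - h))
      = Poly_Mapping.lookup A h * aug B" by (simp flip: sum_distrib_left)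
  qed simp
  finally show ?thesis by (simp add: aug_def sum_distrib_right)
qed

lemma gr_pow_add: "gr_pow (A + B) t = gr_pow A t + gr_pow B t"
  by (simp add: gr_pow_def lookup_add single_add sum.distrib)

lemma gr_pow_zero: "gr_pow 0 t = 0"
  by (simp add: gr_pow_def)

lemma gr_pow_sum: "gr_pow (sum f I) t = (\<Sum>i\<in>I. gr_pow (f i) t)"
  by (induction I rule: infinite_finite_induct) (simp_all add: gr_pow_zero gr_pow_add)

lemma gr_pow_single: "gr_pow (Poly_Mapping.single g a) t = Poly_Mapping.single (of_int t * g) a"
proof -
  have "gr_pow (Poly_Mapping.single g a) t
      = (\<Sum>h\<in>UNIV. if h = g then Poly_Mapping.single (of_int t * g) a else 0)"
    unfolding gr_pow_def by (rule sum.cong) (auto simp: lookup_single when_def)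
  then show ?thesis by simp
qed

text \<open>Multiplication by t is an endomorphism of the additive group, so its linear extension
  respects convolution.\<close>

lemma gr_pow_mult: "gr_pow (A * B) t = gr_pow A t * gr_pow B t"
proof -
  have "A * B = (\<Sum>g\<in>UNIV. \<Sum>h\<in>UNIV. Poly_Mapping.single g (Poly_Mapping.lookup A g)
      * Poly_Mapping.single h (Poly_Mapping.lookup B h))"
    by (subst (1 2) sum_single_lookup[symmetric]) (simp add: sum_product)
  then have "gr_pow (A * B) t = (\<Sum>g\<in>UNIV. \<Sum>h\<in>UNIV.
      Poly_Mapping.single (of_int t * (g + h)) (Poly_Mapping.lookup A g * Poly_Mapping.lookup B h))"
    by (simp add: gr_pow_sum gr_pow_single mult_single)
  also have "\<dots> = gr_pow A t * gr_pow B t"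
    by (simp add: gr_pow_def sum_product mult_single distrib_left)
  finally show ?thesis .
qed

lemma gr_pow_gr_pow: "gr_pow (gr_pow A s) t = gr_pow A (t * s)"
proof -
  have "gr_pow (gr_pow A s) t
      = (\<Sum>g\<in>UNIV. gr_pow (Poly_Mapping.single (of_int s * g) (Poly_Mapping.lookup A g)) t)"
    unfolding gr_pow_def[of A s] by (rule gr_pow_sum)
  then show ?thesis by (simp add: gr_pow_single gr_pow_def[of A] mult.assoc)
qed

lemma of_int_eq_single: "(of_int k :: 'a::comm_monoid_add \<Rightarrow>\<^sub>0 int) = Poly_Mapping.single 0 k"
  by (induction k rule: int_induct[where k = 0]) (simp_all add: single_add single_diff)

lemma gr_pow_of_int: "gr_pow (of_int k) t = of_int k"
  by (simp add: of_int_eq_single gr_pow_single)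

lemma aug_gr_pow: "aug (gr_pow A t) = aug A"
proof -
  have "aug (sum f I) = (\<Sum>i\<in>I. aug (f i))" if "finite I"
    for f :: "C17 \<Rightarrow> C17 \<Rightarrow>\<^sub>0 int" and I
    using that by (induction I) (simp_all add: aug_add, simp add: aug_def)
  then have "aug (gr_pow A t) = (\<Sum>g\<in>UNIV. Poly_Mapping.lookup A g)"
    by (simp add: gr_pow_def aug_single)
  then show ?thesis by (simp add: aug_def)
qed

text \<open>9 is the inverse of 2 modulo 17, so doubling permutes the group.\<close>

lemma nine_mult_two_mult: "9 * (2 * h) = h" "2 * (9 * h) = h" for h :: C17
proof -
  have "9 * 2 = (1 :: C17)" "2 * 9 = (1 :: C17)" by simp_all
  then show "9 * (2 * h) = h" "2 * (9 * h) = h" by (metis mult.assoc mult_1)+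
qed

lemma lookup_gr_pow_two: "Poly_Mapping.lookup (gr_pow A 2) (2 * g) = Poly_Mapping.lookup A g"
proof -
  have "2 * h = 2 * g \<longleftrightarrow> h = g" for h :: C17
    by (metis nine_mult_two_mult(1))
  then show ?thesis
    by (simp add: gr_pow_def lookup_sum lookup_single when_def)
qed

lemma gr_pow_two_group_sum: "gr_pow group_sum 2 = group_sum"
  unfolding group_sum_def gr_pow_sum gr_pow_single
  by (intro sum.reindex_bij_witness[where i = "\<lambda>g. 9 * g" and j = "\<lambda>g. 2 * g"])
    (simp_all only: nine_mult_two_mult UNIV_I of_int_numeral)

lemma lookup_of_int_mult:
  fixes A :: "'a::{finite,ab_group_add} \<Rightarrow>\<^sub>0 int"
  shows "Poly_Mapping.lookup (of_int k * A) g = k * Poly_Mapping.lookup A g"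
  by (simp add: of_int_eq_single lookup_mult_finite lookup_single when_def if_distrib[of "\<lambda>x. x * _"] cong: if_cong)

section \<open>Cancellation of elements with augmentation prime to 17\<close>

lemma eq_zero_if_mult_eq_zero:
  fixes D E :: "C17 \<Rightarrow>\<^sub>0 int"
  assumes "D * E = 0" and "\<not> 17 dvd aug E"
  shows "D = 0"
proof -
  have prime: "prime (17::nat)" by simp
  \<comment> \<open>By Frobenius, \<open>c\<close> is congruent modulo 17 to
    \<open>aug E ^ 17\<close> in the integers and to \<open>E ^ 17\<close> in the group
    ring.\<close>
  define c where "c = (\<Sum>g\<in>UNIV. Poly_Mapping.lookup E g ^ 17)"
  have "17 dvd aug E ^ 17 - c"
    using prime_dvd_power_sum_diff[OF prime, of "Poly_Mapping.lookup E" UNIV]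
    by (simp add: aug_def c_def)
  moreover have "\<not> 17 dvd aug E ^ 17"
    using assms(2) prime_dvd_power[of "17::int"] by auto
  ultimately have "\<not> 17 dvd c"
    by (metis diff_add_cancel dvd_add)
  then have "coprime 17 c" by (intro prime_imp_coprime) auto
  then obtain u v where uv: "u * 17 + v * c = 1"
    by (metis bezout_int coprime_imp_gcd_eq_1)
  \<comment> \<open>Hence the 17th power of every monomial is supported at the identity.\<close>
  have mult_17: "17 * g = 0" for g :: C17
  proof -
    have "17 = (0 :: C17)" by simp
    then show ?thesis by (metis mult_zero_left)
  qed
  have "(\<Sum>g\<in>UNIV. Poly_Mapping.single g (Poly_Mapping.lookup E g) ^ 17) = of_int c"
    by (simp add: c_def single_power mult_17 flip: of_int_eq_single)
  then have "17 dvd E ^ 17 - of_int c"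
    using prime_dvd_power_sum_diff[OF prime,
        of "\<lambda>g. Poly_Mapping.single g (Poly_Mapping.lookup E g)" UNIV]
    by (simp add: sum_single_lookup)
  then obtain z where z: "E ^ 17 = of_int c + 17 * z"
    by (metis dvd_def diff_add_cancel add.commute)
  have "D * E ^ 17 = (D * E) * E ^ 16"
    by (simp add: mult.assoc flip: power_Suc)
  then have Dc: "D * of_int c = - (17 * z * D)"
    using assms(1) z by (simp add: algebra_simps eq_neg_iff_add_eq_0)
  \<comment> \<open>Bezout combined with \<open>Dc\<close> gives D = 17 * w * D, which can then be
    iterated.\<close>
  define w where "w = of_int u - of_int v * z"
  have "D = D * of_int (u * 17 + v * c)" using uv by simp
  also have "\<dots> = of_int u * 17 * D + of_int v * (D * of_int c)"
    by (simp add: algebra_simps)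
  also have "\<dots> = of_int 17 * (w * D)"
    unfolding Dc by (simp add: w_def algebra_simps)
  finally have step: "D = of_int 17 * (w * D)" .
  have D_eq: "D = of_int (17 ^ k) * (w ^ k * D)" for k
  proof (induction k)
    case (Suc k)
    have "of_int (17 ^ k) * (w ^ k * D) = of_int (17 ^ k) * (w ^ k * (of_int 17 * (w * D)))"
      by (rule arg_cong[OF step])
    also have "\<dots> = of_int (17 ^ Suc k) * (w ^ Suc k * D)"
      by (simp only: of_int_mult power_Suc ac_simps)
    finally show ?case using Suc.IH by (rule trans[rotated])
  qed simp
  show "D = 0"
  proof (rule poly_mapping_eqI)
    fix g
    let ?d = "Poly_Mapping.lookup D g"
    \<comment> \<open>Any k with |d| < 17^k would do; |d| itself is large enough.\<close>
    define k where "k = nat \<bar>?d\<bar>"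
    have "?d = 17 ^ k * Poly_Mapping.lookup (w ^ k * D) g"
      using arg_cong[OF D_eq[of k], of "\<lambda>A. Poly_Mapping.lookup A g"]
      by (simp only: lookup_of_int_mult)
    then have "17 ^ k dvd ?d" by (rule dvdI)
    moreover have "\<bar>?d\<bar> < 17 ^ k"
    proof -
      have "k < 17 ^ k" by (rule power_gt_expt) simp
      then have "int k < 17 ^ k" by (metis of_nat_less_iff of_nat_power of_nat_numeral)
      then show ?thesis by (simp add: k_def)
    qed
    ultimately have "?d = 0"
      using dvd_imp_le_int[of ?d "17 ^ k"] by (cases "?d = 0") simp_all
    then show "?d = Poly_Mapping.lookup 0 g" by simp
  qed
qed

section \<open>Convolution sums of functions invariant under doubling\<close>

lemma sum_C17:
  "(\<Sum>h\<in>UNIV. f (h :: C17)) = f 0 + f 1 + f 2 + f 3 + f 4 + f 5 + f 6 + f 7 + f 8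
    + f 9 + f 10 + f 11 + f 12 + f 13 + f 14 + f 15 + f 16"
proof -
  have surj: "of_nat ` {..<17} = (UNIV :: C17 set)"
  proof -
    have "h \<in> of_nat ` {..<17}" for h :: C17
    proof (cases h)
      case (of_int z)
      then have "h = of_nat (nat z)" "nat z < 17" by simp_all
      then show ?thesis by blast
    qed
    then show ?thesis by blast
  qed
  then have "inj_on (of_nat :: nat \<Rightarrow> C17) {..<17}"
    by (intro eq_card_imp_inj_on) simp_all
  then have "(\<Sum>h\<in>UNIV. f h) = (\<Sum>k<17. f (of_nat k))"
    by (simp add: sum.reindex flip: surj)
  also have "{..<17::nat} = {0,1,2,3,4,5,6,7,8,9,10,11,12,13,14,15,16}"
    by (simp add: lessThan_nat_numeral lessThan_Suc insert_commute)
  finally show ?thesis by (simp add: add.assoc)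
qed

lemma uminus_C17:
  "(-1::C17) = 16" "(-2::C17) = 15" "(-3::C17) = 14" "(-4::C17) = 13" "(-5::C17) = 12"
  "(-6::C17) = 11" "(-7::C17) = 10" "(-8::C17) = 9" "(-9::C17) = 8" "(-10::C17) = 7"
  "(-11::C17) = 6" "(-12::C17) = 5" "(-13::C17) = 4" "(-14::C17) = 3" "(-15::C17) = 2"
  "(-16::C17) = 1"
  by simp_all

text \<open>2 has order 8 modulo 17, so doubling has two orbits of length 8 on the nonzero residues,
  those of 1 and 3.\<close>

lemma two_invariant:
  fixes L :: "C17 \<Rightarrow> 'a"
  assumes "\<And>g. L (2 * g) = L g"
  shows "L 2 = L 1" "L 4 = L 1" "L 8 = L 1" "L 9 = L 1" "L 13 = L 1" "L 15 = L 1" "L 16 = L 1"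
    and "L 5 = L 3" "L 6 = L 3" "L 7 = L 3" "L 10 = L 3" "L 11 = L 3" "L 12 = L 3" "L 14 = L 3"
proof -
  have mod: "2 * 8 = (16::C17)" "2 * 16 = (15::C17)" "2 * 15 = (13::C17)" "2 * 13 = (9::C17)"
    "2 * 12 = (7::C17)" "2 * 7 = (14::C17)" "2 * 14 = (11::C17)" "2 * 11 = (5::C17)"
    "2 * 1 = (2::C17)" "2 * 2 = (4::C17)" "2 * 4 = (8::C17)"
    "2 * 3 = (6::C17)" "2 * 6 = (12::C17)" "2 * 5 = (10::C17)"
    by simp_all
  show 1: "L 2 = L 1" using assms[of 1] unfolding mod .
  show 2: "L 4 = L 1" using assms[of 2] unfolding mod 1 .
  show 3: "L 8 = L 1" using assms[of 4] unfolding mod 2 .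
  show 4: "L 16 = L 1" using assms[of 8] unfolding mod 3 .
  show 5: "L 15 = L 1" using assms[of 16] unfolding mod 4 .
  show 6: "L 13 = L 1" using assms[of 15] unfolding mod 5 .
  show "L 9 = L 1" using assms[of 13] unfolding mod 6 .
  show 7: "L 6 = L 3" using assms[of 3] unfolding mod .
  show 8: "L 12 = L 3" using assms[of 6] unfolding mod 7 .
  show 9: "L 7 = L 3" using assms[of 12] unfolding mod 8 .
  show 10: "L 14 = L 3" using assms[of 7] unfolding mod 9 .
  show 11: "L 11 = L 3" using assms[of 14] unfolding mod 10 .
  show 12: "L 5 = L 3" using assms[of 11] unfolding mod 11 .
  show "L 10 = L 3" using assms[of 5] unfolding mod 12 .
qed

text \<open>The representatives 0, 1, 3 stand for zero, the nonzero squares and the nonsquares modulo 17.\<close>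

lemma sum_two_invariant:
  fixes L :: "C17 \<Rightarrow> int"
  assumes "\<And>g. L (2 * g) = L g"
  shows "(\<Sum>h\<in>UNIV. L h) = L 0 + 8 * L 1 + 8 * L 3"
    and "(\<Sum>h\<in>UNIV. L h * L (0 - h)) = (L 0)^2 + 8 * (L 1)^2 + 8 * (L 3)^2"
    and "(\<Sum>h\<in>UNIV. L h * L (1 - h))
      = 2 * L 0 * L 1 + 3 * (L 1)^2 + 4 * (L 3)^2 + 8 * L 1 * L 3"
    and "(\<Sum>h\<in>UNIV. L h * L (3 - h))
      = 2 * L 0 * L 3 + 4 * (L 1)^2 + 3 * (L 3)^2 + 8 * L 1 * L 3"
proof -
  \<comment> \<open>2^4 = 16 = -1 in the group, so invariance under doubling makes \<open>L\<close>
    even.\<close>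
  have neg: "L (- h) = L h" for h
  proof -
    have "16 * h = 2 * (2 * (2 * (2 * h)))" by simp
    then have "L (16 * h) = L h" by (simp only: assms)
    moreover have "- h = 16 * h" using uminus_C17(1) by (metis mult_minus1)
    ultimately show ?thesis by (simp only:)
  qed
  note L = two_invariant[of L, OF assms]
  show "(\<Sum>h\<in>UNIV. L h) = L 0 + 8 * L 1 + 8 * L 3"
    by (simp add: sum_C17 L)
  show "(\<Sum>h\<in>UNIV. L h * L (0 - h)) = (L 0)^2 + 8 * (L 1)^2 + 8 * (L 3)^2"
    by (simp add: sum_C17 neg L power2_eq_square)
  have sub1: "L (1 - h) = L (h - 1)" and sub3: "L (3 - h) = L (h - 3)" for h
    using neg[of "h - 1"] neg[of "h - 3"] by simp_all
  \<comment> \<open>Apart from h = 0 and h = 1, there are 3 values with h and 1 - h both squares, 4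
    with both nonsquares and 8 mixed. For 3, a nonsquare, the two classes swap roles.\<close>
  show "(\<Sum>h\<in>UNIV. L h * L (1 - h))
      = 2 * L 0 * L 1 + 3 * (L 1)^2 + 4 * (L 3)^2 + 8 * L 1 * L 3"
    by (simp add: sum_C17 sub1 neg L power2_eq_square)
  show "(\<Sum>h\<in>UNIV. L h * L (3 - h))
      = 2 * L 0 * L 3 + 4 * (L 1)^2 + 3 * (L 3)^2 + 8 * L 1 * L 3"
    by (simp add: sum_C17 sub3 neg L power2_eq_square)
qed

section \<open>Four-cycles of x -> c - x^2 and invariance under doubling\<close>

text \<open>Factoring differences of squares, multiplication by \<open>x\<^sub>0 + x\<^sub>2\<close>
  takes \<open>x\<^sub>0 - x\<^sub>2\<close> to \<open>x\<^sub>3 - x\<^sub>1\<close>, and then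
  \<open>x\<^sub>1 + x\<^sub>3\<close> takes this to \<open>x\<^sub>2 - x\<^sub>0\<close>, the
  negative of the start.\<close>

lemma four_cycle_identity:
  fixes x\<^sub>0 x\<^sub>1 x\<^sub>2 x\<^sub>3 c :: "'a::comm_ring_1"
  assumes "x\<^sub>0 * x\<^sub>0 + x\<^sub>1 = c" "x\<^sub>1 * x\<^sub>1 + x\<^sub>2 = c" "x\<^sub>2 * x\<^sub>2 + x\<^sub>3 = c" "x\<^sub>3 * x\<^sub>3 + x\<^sub>0 = c"
  shows "(x\<^sub>0 - x\<^sub>2) * (1 + (x\<^sub>0 + x\<^sub>2) * (x\<^sub>1 + x\<^sub>3)) = 0"
proof -
  have x0: "x\<^sub>0 = c - x\<^sub>3 * x\<^sub>3" and x1: "x\<^sub>1 = c - x\<^sub>0 * x\<^sub>0" and x2: "x\<^sub>2 = c - x\<^sub>1 * x\<^sub>1" and x3: "x\<^sub>3 = c - x\<^sub>2 * x\<^sub>2"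
    using assms by (simp_all add: eq_diff_eq add.commute)
  have "(x\<^sub>0 - x\<^sub>2) * (x\<^sub>0 + x\<^sub>2) = (c - x\<^sub>2 * x\<^sub>2) - (c - x\<^sub>0 * x\<^sub>0)"
    by (simp add: algebra_simps)
  also have "\<dots> = x\<^sub>3 - x\<^sub>1" unfolding x1[symmetric] x3[symmetric] ..
  finally have 1: "(x\<^sub>0 - x\<^sub>2) * (x\<^sub>0 + x\<^sub>2) = x\<^sub>3 - x\<^sub>1" .
  have "(x\<^sub>3 - x\<^sub>1) * (x\<^sub>1 + x\<^sub>3) = (c - x\<^sub>1 * x\<^sub>1) - (c - x\<^sub>3 * x\<^sub>3)"
    by (simp add: algebra_simps)
  also have "\<dots> = x\<^sub>2 - x\<^sub>0" unfolding x0[symmetric] x2[symmetric] ..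
  finally have 2: "(x\<^sub>3 - x\<^sub>1) * (x\<^sub>1 + x\<^sub>3) = x\<^sub>2 - x\<^sub>0" .
  have "(x\<^sub>0 - x\<^sub>2) * (1 + (x\<^sub>0 + x\<^sub>2) * (x\<^sub>1 + x\<^sub>3))
      = (x\<^sub>0 - x\<^sub>2) + ((x\<^sub>0 - x\<^sub>2) * (x\<^sub>0 + x\<^sub>2)) * (x\<^sub>1 + x\<^sub>3)"
    by (simp only: distrib_left[of _ 1] mult_1_right mult.assoc)
  then show ?thesis by (simp add: 1 2)
qed

lemma gr_pow_eq_self:
  fixes T :: "C17 \<Rightarrow>\<^sub>0 int" and k l :: int
  assumes aug: "17 dvd (aug T)\<^sup>2 + 1"
    and sym: "T = gr_pow T (- 1)"
    and sq: "T\<^sup>2 = of_int k * group_sum - gr_pow T 2 + of_int l"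
  shows "gr_pow T 2 = T"
proof -
  define T1 T2 T3 where "T1 = gr_pow T 2" and "T2 = gr_pow T1 2" and "T3 = gr_pow T2 2"
  \<comment> \<open>The power map fixes \<open>c\<close>, so applying it repeatedly to the relation
    for \<open>T\<close> produces the whole cycle.\<close>
  define c where "c = of_int k * group_sum + of_int l"
  have gr_pow_c: "gr_pow c 2 = c"
    by (simp add: c_def gr_pow_add gr_pow_mult gr_pow_of_int gr_pow_two_group_sum)
  have T4: "gr_pow T3 2 = T"
  proof -
    have "gr_pow T3 2 = gr_pow T 16"
      by (simp add: T1_def T2_def T3_def gr_pow_gr_pow)
    also have "\<dots> = gr_pow T (- 1)"
      by (simp add: gr_pow_def uminus_C17)
    finally show ?thesis using sym by simp
  qed
  have eq0: "T * T + T1 = c"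
    using sq by (simp add: T1_def c_def power2_eq_square)
  from arg_cong[OF this, of "\<lambda>A. gr_pow A 2"] have eq1: "T1 * T1 + T2 = c"
    by (simp add: gr_pow_add gr_pow_mult gr_pow_c T1_def T2_def)
  from arg_cong[OF this, of "\<lambda>A. gr_pow A 2"] have eq2: "T2 * T2 + T3 = c"
    by (simp add: gr_pow_add gr_pow_mult gr_pow_c T2_def T3_def flip: T1_def)
  from arg_cong[OF this, of "\<lambda>A. gr_pow A 2"] have eq3: "T3 * T3 + T = c"
    by (simp add: gr_pow_add gr_pow_mult gr_pow_c T4 flip: T3_def)
  have augs: "aug T1 = aug T" "aug T2 = aug T" "aug T3 = aug T"
    by (simp_all add: T1_def T2_def T3_def aug_gr_pow)
  have "T - T2 = 0"
  proof (rule eq_zero_if_mult_eq_zero)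
    show "(T - T2) * (1 + (T + T2) * (T1 + T3)) = 0"
      using eq0 eq1 eq2 eq3 by (rule four_cycle_identity)
    \<comment> \<open>Congruent to -3 modulo 17 by the assumption on \<open>aug T\<close>.\<close>
    have "aug (1 + (T + T2) * (T1 + T3)) = 4 * ((aug T)\<^sup>2 + 1) - 3"
      by (simp add: aug_add aug_mult aug_one augs power2_eq_square algebra_simps)
    then show "\<not> 17 dvd aug (1 + (T + T2) * (T1 + T3))"
      using aug by presburger
  qed
  then have T2: "T2 = T" by simp
  have "T - T1 = 0"
  proof (rule eq_zero_if_mult_eq_zero)
    \<comment> \<open>This is the difference of \<open>eq0\<close> and \<open>eq1\<close> once
      \<open>T2\<close> is replaced by \<open>T\<close>.\<close>
    show "(T - T1) * (T + T1 + of_int (- 1)) = 0"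
      using eq0 eq1 unfolding T2 by (simp add: algebra_simps)
    have "aug (T + T1 + of_int (- 1)) = 2 * aug T - 1"
      by (simp add: aug_add augs of_int_eq_single aug_single del: of_int_minus)
    moreover have "\<not> 17 dvd 2 * aug T - 1"
    proof
      assume "17 dvd 2 * aug T - 1"
      \<comment> \<open>The conjugate factor brings in the square of \<open>aug T\<close>, leaving
        -5 modulo 17.\<close>
      then have "17 dvd (2 * aug T - 1) * (2 * aug T + 1)" by (rule dvd_mult2)
      also have "\<dots> = 4 * ((aug T)\<^sup>2 + 1) - 5"
        by (simp add: power2_eq_square algebra_simps)
      finally show False using aug by presburger
    qed
    ultimately show "\<not> 17 dvd aug (T + T1 + of_int (- 1))" by simp
  qed
  then show ?thesis by (simp add: T1_def)
qed

section \<open>Comparison of coefficients and the contradiction\<close>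

theorem theorem6:
  fixes n m :: nat
  assumes "n > 0"
    and "17 dvd 2 * n^2 + 2 * n + 1"
    and "\<not> is_square (8 * n + 1)"
    and "m = (2 * n^2 + 2 * n + 1) div 17"
  shows "\<not> (\<exists>T :: C17 \<Rightarrow>\<^sub>0 int.
           (\<forall>g. Poly_Mapping.lookup T g \<ge> 0) \<and>
           (\<Sum>g\<in>UNIV. Poly_Mapping.lookup T g) = 2 * int n + 1 \<and>
           T = gr_pow T (- 1) \<and>
           T^2 = of_int (2 * int m) * group_sum - gr_pow T 2 + of_int (2 * int n))"
proof
  assume "\<exists>T :: C17 \<Rightarrow>\<^sub>0 int.
           (\<forall>g. Poly_Mapping.lookup T g \<ge> 0) \<and>
           (\<Sum>g\<in>UNIV. Poly_Mapping.lookup T g) = 2 * int n + 1 \<and>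
           T = gr_pow T (- 1) \<and>
           T^2 = of_int (2 * int m) * group_sum - gr_pow T 2 + of_int (2 * int n)"
  then obtain T :: "C17 \<Rightarrow>\<^sub>0 int" where
    sum: "(\<Sum>g\<in>UNIV. Poly_Mapping.lookup T g) = 2 * int n + 1" and
    sym: "T = gr_pow T (- 1)" and
    sq: "T\<^sup>2 = of_int (2 * int m) * group_sum - gr_pow T 2 + of_int (2 * int n)"
    by blast
  \<comment> \<open>(2n + 1)^2 + 1 = 2(2n^2 + 2n + 1).\<close>
  have dvd: "17 dvd (2 * int n + 1)\<^sup>2 + 1"
  proof -
    have "17 dvd int (2 * (2 * n\<^sup>2 + 2 * n + 1))"
      using assms(2) by presburger
    then show ?thesis by (simp add: power2_eq_square algebra_simps)
  qed
  have inv: "gr_pow T 2 = T"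
    using gr_pow_eq_self[OF _ sym sq] dvd sum by (simp add: aug_def)
  define L where "L = Poly_Mapping.lookup T"
  have L: "L (2 * g) = L g" for g
    using lookup_gr_pow_two[of T g] by (simp add: inv L_def)
  have coeff: "(\<Sum>h\<in>UNIV. L h * L (g - h)) = 2 * int m - L g + (if g = 0 then 2 * int n else 0)" for g
  proof -
    have "Poly_Mapping.lookup group_sum g = 1"
      by (simp add: group_sum_def lookup_sum lookup_single when_def)
    moreover have "Poly_Mapping.lookup (of_int (2 * int n)) g = (if g = 0 then 2 * int n else 0)"
      by (simp only: of_int_eq_single lookup_single when_def) simp
    ultimately show ?thesis
      using arg_cong[OF sq, of "\<lambda>A. Poly_Mapping.lookup A g"]
      by (simp only: power2_eq_square lookup_mult_finite[of T] L_def inv lookup_add lookup_minus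
          lookup_of_int_mult mult_1_right)
  qed
  note sums = sum_two_invariant[of L, OF L]
  define a b c where "a = L 0" and "b = L 1" and "c = L 3"
  have "a + 8 * b + 8 * c = 2 * int n + 1"
    using sum sums(1) by (simp add: L_def a_def b_def c_def)
  moreover have at0: "a\<^sup>2 + 8 * b\<^sup>2 + 8 * c\<^sup>2 = 2 * int m - a + 2 * int n"
    using coeff[of 0] unfolding sums by (simp add: a_def b_def c_def)
  moreover have at1: "2 * a * b + 3 * b\<^sup>2 + 4 * c\<^sup>2 + 8 * b * c = 2 * int m - b"
    using coeff[of 1] unfolding sums by (simp add: a_def b_def c_def)
  moreover have at3: "2 * a * c + 4 * b\<^sup>2 + 3 * c\<^sup>2 + 8 * b * c = 2 * int m - c"
    using coeff[of 3] unfolding sums by (simp add: a_def b_def c_def)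
  \<comment> \<open>Subtracting \<open>at3\<close> from \<open>at1\<close> eliminates m and the
    mixed term.\<close>
  ultimately have "(b - c) * (2 * a + 1 - (b + c)) = 0"
    by (simp add: power2_eq_square algebra_simps)
  then consider "b = c" | "b + c = 2 * a + 1" by auto
  then show False
  proof cases
    case 1
    \<comment> \<open>With b = c, \<open>at0\<close> minus \<open>at1\<close> reads (a - b)^2 + (a -
      b) = 2n; complete the square.\<close>
    have "int (8 * n + 1) = (2 * (a - b) + 1)\<^sup>2"
      using at0 at1 by (simp add: 1 power2_eq_square algebra_simps)
    also have "\<dots> = int ((nat \<bar>2 * (a - b) + 1\<bar>)\<^sup>2)" by simp
    finally have "8 * n + 1 = (nat \<bar>2 * (a - b) + 1\<bar>)\<^sup>2"
      by (simp only: of_nat_eq_iff)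
    then show False using assms(3) by (metis is_nth_power_def)
  next
    case 2
    \<comment> \<open>a + 8(2a + 1) = 17a + 8, and 8^2 + 1 = 65 leaves 14 modulo 17.\<close>
    then have "2 * int n + 1 = 17 * a + 8"
      using \<open>a + 8 * b + 8 * c = 2 * int n + 1\<close> by simp
    then have "(2 * int n + 1)\<^sup>2 + 1 = 17 * (17 * a\<^sup>2 + 16 * a + 3) + 14"
      by (simp add: power2_eq_square algebra_simps)
    then show False using dvd by presburger
  qed
qed
end
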